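(* For complex numbers $a,b,x\in\mathbb{C}\setminus\{-1,-2,-3,\ldots\}$ define $$f(a,b):=\prod_{n\ge 1}\left(\frac{n+a}{n+b}\right)^{(-1)^{t_n}},\qquad g(x):=\frac{f\left(\frac{x}{2},\frac{x+1}{2}\right)}{x+1}.$$ Then for all $a,b\in\mathbb{C}\setminus\{-1,-2,-3,\ldots\}$, $$f(a,b)=\frac{g(a)}{g(b)}.$$ Furthermore, $g$ satisfies the functional equation $$(1+x)\,g(x)=\frac{g\left(\frac{x}{2}\right)}{g\left(\frac{x+1}{2}\right)}\qquad\text{for all }x\in\mathbb{C}\setminus\{-1,-2,-3,\ldots\}.$$ In particular, $g(1/2)=1$ and $g(1)=\sqrt{2}/2$.
   Context: For an integer $n\ge 0$, $t_n\in\{0,1\}$ denotes the sum modulo $2$ of the binary digits of $n$ (the Thue-Morse sequence $0,1,1,0,1,0,0,1,\ldots$); equivalently $t_0=0$, $t_{2n}=t_n$, $t_{2n+1}=1-t_n$. Infinite products are limits of the partial products taken in increasing order of $n$ (they need not converge absolutely); an infinite product of nonzero complex numbers converges if its partial products tend to a finite nonzero limit. *)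

theory Defs
  imports "HOL-Analysis.Analysis"
begin

text \<open>The term with index \<open>k\<close> is the binary digit of \<open>n\<close> at position \<open>k\<close>. Since
  \<open>n < 2 ^ n\<close>, all digits at positions \<open>k \<ge> n\<close> vanish, so the sum covers every binary digit.\<close>

definition thue_morse :: "nat \<Rightarrow> nat" where
  "thue_morse n = (\<Sum>k<n. n div 2 ^ k mod 2) mod 2"

definition off_neg_ints :: "complex set" where
  "off_neg_ints = {z. \<forall>n\<ge>1. z \<noteq> - of_nat n}"

text \<open>The products start at index 1, whereas the library's infinite products start at
  index 0; hence the factors are indexed by \<open>Suc n\<close>.\<close>

definition tm_factor :: "complex \<Rightarrow> complex \<Rightarrow> nat \<Rightarrow> complex" where
  "tm_factor a b n = ((of_nat n + a) / (of_nat n + b)) powi ((- 1) ^ thue_morse n)"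

definition tm_f :: "complex \<Rightarrow> complex \<Rightarrow> complex" where
  "tm_f a b = (\<Prod>n. tm_factor a b (Suc n))"

definition tm_g :: "complex \<Rightarrow> complex" where
  "tm_g x = tm_f (x / 2) ((x + 1) / 2) / (x + 1)"

end

theory Submission
  imports Defs "HOL-Probability.Characteristic_Functions"
begin

text \<open>Grouping the factors with indices \<open>2n\<close> and \<open>2n + 1\<close>, which carry opposite exponents, gives
  factors of size \<open>1 + O(1/n\<^sup>2)\<close>, so the product converges. Separating instead the even from
  the odd indices yields
  \<open>f(a, b) = (1 + b) / (1 + a) \<cdot> f(a/2, b/2) / f((a+1)/2, (b+1)/2)\<close>.
  Since \<open>f(a, b) f(c, d)\<close> is invariant under exchanging \<open>b\<close> and \<open>d\<close>, the right-hand side equals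
  \<open>g(a) / g(b)\<close>. The functional equation is the case \<open>(a, b) = (x/2, (x+1)/2)\<close>; its instances
  \<open>x = 0\<close> and \<open>x = 1\<close> give \<open>g(1/2) = 1\<close> and \<open>g(1)\<^sup>2 = 1/2\<close>, and \<open>g(1) \<ge> 0\<close> because all the factors
  of \<open>f(1/2, 1)\<close> are positive.\<close>

section \<open>Recursion of the Thue-Morse sequence\<close>

lemma sum_binary_digits_extend:
  fixes n m :: nat
  assumes "n \<le> m"
  shows "(\<Sum>k<m. n div 2 ^ k mod 2) = (\<Sum>k<n. n div 2 ^ k mod 2)"
proof (rule sum.mono_neutral_right)
  show "\<forall>k\<in>{..<m} - {..<n}. n div 2 ^ k mod 2 = 0"
  proof
    fix k assume "k \<in> {..<m} - {..<n}"
    then have "n < 2 ^ k"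
      by (auto intro: less_le_trans[OF less_exp])
    then show "n div 2 ^ k mod 2 = 0" by simp
  qed
qed (use assms in auto)

text \<open>The range of summation depends on \<open>n\<close>, so a zero digit is appended first:
  splitting off position 0 then leaves \<open>k < n\<close>, which can be cut to
  \<open>k < n div 2\<close>.\<close>

lemma sum_binary_digits_rec:
  fixes n :: nat
  shows "(\<Sum>k<n. n div 2 ^ k mod 2) = n mod 2 + (\<Sum>k<n div 2. n div 2 div 2 ^ k mod 2)"
proof -
  have "(\<Sum>k<n. n div 2 ^ k mod 2) = (\<Sum>k<Suc n. n div 2 ^ k mod 2)"
    by (rule sum_binary_digits_extend[symmetric]) simp
  also have "\<dots> = n mod 2 + (\<Sum>k<n. n div 2 div 2 ^ k mod 2)"
    by (subst sum.lessThan_Suc_shift) (simp add: div_mult2_eq)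
  also have "(\<Sum>k<n. n div 2 div 2 ^ k mod 2) = (\<Sum>k<n div 2. n div 2 div 2 ^ k mod 2)"
    by (rule sum_binary_digits_extend) simp
  finally show ?thesis .
qed

lemma thue_morse_double: "thue_morse (2 * n) = thue_morse n"
  unfolding thue_morse_def by (subst sum_binary_digits_rec) simp

lemma thue_morse_Suc_double: "thue_morse (Suc (2 * n)) = (1 + thue_morse n) mod 2"
proof -
  have "(\<Sum>k<Suc (2 * n). Suc (2 * n) div 2 ^ k mod 2) = 1 + (\<Sum>k<n. n div 2 ^ k mod 2)"
    by (subst sum_binary_digits_rec) simp
  then show ?thesis
    unfolding thue_morse_def by (simp only: mod_add_right_eq)
qed

lemma thue_morse_cases: "thue_morse n = 0 \<or> thue_morse n = 1"
  unfolding thue_morse_def by auto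

section \<open>The domain \<open>off_neg_ints\<close>\<close>

lemma of_nat_add_nonzero:
  assumes "a \<in> off_neg_ints" "n \<ge> 1"
  shows "of_nat n + a \<noteq> 0"
proof
  assume "of_nat n + a = 0"
  then have "a = - of_nat n" by (simp add: eq_neg_iff_add_eq_0 add.commute)
  with assms show False by (auto simp: off_neg_ints_def)
qed

lemma half_in_off_neg_ints:
  assumes "x \<in> off_neg_ints"
  shows "x / 2 \<in> off_neg_ints"
  unfolding off_neg_ints_def
proof safe
  fix n :: nat assume "n \<ge> 1" "x / 2 = - of_nat n"
  then have "x = - of_nat (2 * n)" by (simp add: field_simps)
  with assms \<open>n \<ge> 1\<close> show False
    unfolding off_neg_ints_def by (auto dest!: spec[of _ "2 * n"])
qed

lemma half_Suc_in_off_neg_ints: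
  assumes "x \<in> off_neg_ints"
  shows "(x + 1) / 2 \<in> off_neg_ints"
  unfolding off_neg_ints_def
proof safe
  fix n :: nat assume "n \<ge> 1" "(x + 1) / 2 = - of_nat n"
  then have "x + 1 = - of_nat (2 * n)" by (simp add: field_simps)
  then have "x = - of_nat (2 * n) - 1" by (simp only: eq_diff_eq)
  then have "x = - of_nat (2 * n + 1)" by simp
  with assms \<open>n \<ge> 1\<close> show False
    unfolding off_neg_ints_def by (auto dest!: spec[of _ "2 * n + 1"])
qed

section \<open>Identities for single factors\<close>

lemma tm_factor_nonzero:
  assumes "a \<in> off_neg_ints" "b \<in> off_neg_ints" "n \<ge> 1"
  shows "tm_factor a b n \<noteq> 0"
  using of_nat_add_nonzero[OF assms(1,3)] of_nat_add_nonzero[OF assms(2,3)]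
  by (simp add: tm_factor_def)

lemma add_half_divide:
  fixes a b :: complex
  shows "(of_nat n + a / 2) / (of_nat n + b / 2) = (of_nat (2 * n) + a) / (of_nat (2 * n) + b)"
proof -
  have "of_nat (2 * n) + c = 2 * (of_nat n + c / 2)" for c :: complex
    by simp
  then show ?thesis
    by (simp only:) (rule mult_divide_mult_cancel_left[symmetric], simp)
qed

lemma tm_factor_double: "tm_factor a b (2 * n) = tm_factor (a / 2) (b / 2) n"
  by (simp add: tm_factor_def thue_morse_double add_half_divide del: of_nat_mult)

text \<open>The digit sums of \<open>n\<close> and \<open>2 * n + 1\<close> differ in parity, so the
  exponent changes sign. A vanishing numerator or denominator is harmless because
  \<open>inverse 0 = 0\<close>.\<close>

lemma tm_factor_Suc_double:
  "tm_factor a b (Suc (2 * n)) = inverse (tm_factor ((a + 1) / 2) ((b + 1) / 2) n)"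
proof -
  have "(of_nat n + (a + 1) / 2) / (of_nat n + (b + 1) / 2)
      = (of_nat (Suc (2 * n)) + a) / (of_nat (Suc (2 * n)) + b)"
    by (subst add_half_divide) (simp add: algebra_simps)
  then show ?thesis
    using thue_morse_cases[of n]
    by (auto simp add: tm_factor_def thue_morse_Suc_double power_int_minus simp del: of_nat_Suc)
qed

text \<open>Both factors have the same exponent, so their bases multiply, and the product of two
  fractions is symmetric in the denominators.\<close>

lemma tm_factor_exchange:
  "tm_factor a b n * tm_factor c d n = tm_factor a d n * tm_factor c b n"
  unfolding tm_factor_def power_int_mult_distrib[symmetric] times_divide_times_eq
  by (simp only: mult.commute)

section \<open>Convergence of the product\<close>

lemma tm_factor_pair_minus_one_bound:
  assumes a: "a \<in> off_neg_ints" and b: "b \<in> off_neg_ints"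
    and n: "n \<ge> 1" "norm a \<le> n" "norm b \<le> n"
  shows "norm (tm_factor a b (2 * n) * tm_factor a b (Suc (2 * n)) - 1) \<le> norm (a - b) / real n ^ 2"
proof -
  define p where "p = (\<lambda>c::complex. of_nat (2 * n) + c)"
  define q where "q = (\<lambda>c::complex. of_nat (Suc (2 * n)) + c)"
  have nz: "p a \<noteq> 0" "p b \<noteq> 0" "q a \<noteq> 0" "q b \<noteq> 0"
    unfolding p_def q_def using n by (intro of_nat_add_nonzero a b; simp)+
  \<comment> \<open>By the triangle inequality both factors of the denominator have norm at least
    \<open>2 * n - n = n\<close>.\<close>
  have bound: "norm ((c - d) / (p d * q c)) \<le> norm (c - d) / real n ^ 2"
    if "norm c \<le> n" "norm d \<le> n" for c d
  proof -
    have "real (2 * n) \<le> norm (p d) + norm d"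
      using norm_triangle_ineq4[of "p d" d] by (simp add: p_def norm_mult)
    then have p: "real n \<le> norm (p d)" using that by simp
    have "norm (of_nat (Suc (2 * n)) :: complex) \<le> norm (q c) + norm c"
      using norm_triangle_ineq4[of "q c" c] by (simp add: q_def del: of_nat_Suc)
    then have "real n \<le> norm (q c)" using that unfolding norm_of_nat by simp
    with p have "real n ^ 2 \<le> norm (p d * q c)"
      by (simp add: norm_mult power2_eq_square mult_mono)
    then show ?thesis
      using n by (simp only: norm_divide) (intro divide_left_mono, auto simp: zero_less_mult_iff nz)
  qed
  \<comment> \<open>Since \<open>q\<close> exceeds \<open>p\<close> by 1, the numerator
    \<open>p c * q d - p d * q c\<close> collapses to \<open>c - d\<close>, which leaves a term of
    quadratic decay.\<close>
  have pair: "(p c / p d) * (q d / q c) - 1 = (c - d) / (p d * q c)"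
    if "p d \<noteq> 0" "q c \<noteq> 0" for c d
    using that by (simp add: field_simps) (simp add: p_def q_def algebra_simps)
  from thue_morse_cases[of n] show ?thesis
  proof
    assume t: "thue_morse n = 0"
    then have "tm_factor a b (2 * n) * tm_factor a b (Suc (2 * n)) - 1 = (p a / p b) * (q b / q a) - 1"
      unfolding tm_factor_def thue_morse_double thue_morse_Suc_double
      by (simp add: p_def q_def power_int_minus)
    then show ?thesis using bound[of a b] pair[of b a] nz n by simp
  next
    assume t: "thue_morse n = 1"
    then have "tm_factor a b (2 * n) * tm_factor a b (Suc (2 * n)) - 1 = (p b / p a) * (q a / q b) - 1"
      unfolding tm_factor_def thue_morse_double thue_morse_Suc_double
      by (simp add: p_def q_def power_int_minus)
    then show ?thesis using bound[of b a] pair[of a b] nz n by (simp add: norm_minus_commute)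
  qed
qed

text \<open>Comparison with the sum of \<open>1 / n ^ 2\<close>. The pairs start at the indices 2
  and 3; the factor of index 1 stays outside.\<close>

lemma convergent_prod_tm_factor_pairs:
  assumes a: "a \<in> off_neg_ints" and b: "b \<in> off_neg_ints"
  shows "convergent_prod (\<lambda>n. tm_factor a b (2 * Suc n) * tm_factor a b (Suc (2 * Suc n)))"
proof (intro abs_convergent_prod_imp_convergent_prod)
  have "summable (\<lambda>n. norm (a - b) * (1 / real (Suc n) ^ 2))"
    using inverse_power_summable[of 2, where 'a = real]
    by (intro summable_mult) (subst summable_Suc_iff, simp add: field_simps)
  moreover have "\<forall>\<^sub>F n in sequentially. norm a \<le> real (Suc n) \<and> norm b \<le> real (Suc n)"
    unfolding eventually_sequentially
    by (rule exI[of _ "nat \<lceil>max (norm a) (norm b)\<rceil>"]) linarith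
  then have "\<forall>\<^sub>F n in sequentially.
      norm (norm (tm_factor a b (2 * Suc n) * tm_factor a b (Suc (2 * Suc n)) - 1))
        \<le> norm (a - b) * (1 / real (Suc n) ^ 2)"
    by eventually_elim
      (use tm_factor_pair_minus_one_bound[OF a b] in \<open>simp del: of_nat_Suc mult_Suc_right\<close>)
  ultimately have "summable (\<lambda>n. norm (tm_factor a b (2 * Suc n) * tm_factor a b (Suc (2 * Suc n)) - 1))"
    by (rule summable_comparison_test_ev[rotated])
  then show "abs_convergent_prod (\<lambda>n. tm_factor a b (2 * Suc n) * tm_factor a b (Suc (2 * Suc n)))"
    by (simp only: abs_convergent_prod_conv_summable)
qed

lemma filterlim_of_nat_add_at_infinity: "filterlim (\<lambda>n. of_nat n + c :: complex) at_infinity sequentially"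
  by (rule tendsto_add_filterlim_at_infinity'[OF tendsto_of_nat tendsto_const])

text \<open>Controls the partial products that stop in the middle of a pair.\<close>

lemma tm_factor_tendsto_1: "tm_factor a b \<longlonglongrightarrow> 1"
proof -
  have "(\<lambda>n. 1 + (a - b) / (of_nat n + b)) \<longlonglongrightarrow> 1 + 0"
    by (intro tendsto_add tendsto_const tendsto_divide_0[OF tendsto_const filterlim_of_nat_add_at_infinity])
  moreover have "\<forall>\<^sub>F n in sequentially. of_nat n + b \<noteq> 0"
    using filterlim_at_infinity_imp_eventually_ne[OF filterlim_of_nat_add_at_infinity] .
  then have "\<forall>\<^sub>F n in sequentially. 1 + (a - b) / (of_nat n + b) = (of_nat n + a) / (of_nat n + b)"
    by eventually_elim (simp add: field_simps)
  ultimately have lim: "(\<lambda>n. (of_nat n + a) / (of_nat n + b)) \<longlonglongrightarrow> 1"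
    by (simp add: tendsto_cong)
  \<comment> \<open>\<open>h\<close> dominates the error for either exponent, so one limit covers
    all values of \<open>thue_morse n\<close>.\<close>
  define h where "h = (\<lambda>z::complex. norm (z - 1) + norm (inverse z - 1))"
  have bound: "norm (tm_factor a b n - 1) \<le> h ((of_nat n + a) / (of_nat n + b))" for n
    using thue_morse_cases[of n] by (auto simp: tm_factor_def h_def power_int_minus)
  have "(\<lambda>n. h ((of_nat n + a) / (of_nat n + b))) \<longlonglongrightarrow> h 1"
    unfolding h_def by (intro tendsto_intros lim) simp
  then have "(\<lambda>n. h ((of_nat n + a) / (of_nat n + b))) \<longlonglongrightarrow> 0"
    by (simp add: h_def)
  then have "(\<lambda>n. tm_factor a b n - 1) \<longlonglongrightarrow> 0"
    by (rule Lim_null_comparison[OF always_eventually[OF allI[OF bound]]])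
  then show ?thesis by (simp add: LIM_zero_iff)
qed

lemma convergent_prod_tm_factor:
  assumes a: "a \<in> off_neg_ints" and b: "b \<in> off_neg_ints"
  shows "convergent_prod (\<lambda>n. tm_factor a b (Suc n))"
proof -
  define Q where "Q = (\<lambda>n. tm_factor a b (2 * Suc n) * tm_factor a b (Suc (2 * Suc n)))"
  \<comment> \<open>\<open>T n\<close> covers the indices 1 to \<open>n + 1\<close>, so
    \<open>T (2 * n)\<close> consists of the factor of index 1 and \<open>n\<close> complete
    pairs.\<close>
  define T where "T = (\<lambda>n. \<Prod>k\<le>n. tm_factor a b (Suc k))"
  define L where "L = tm_factor a b 1 * prodinf Q"
  have Q: "convergent_prod Q"
    unfolding Q_def by (rule convergent_prod_tm_factor_pairs[OF a b])
  have Q_nz: "Q n \<noteq> 0" for n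
    unfolding Q_def by (simp add: tm_factor_nonzero a b del: mult_Suc_right)
  have even: "T (2 * n) = tm_factor a b 1 * (\<Prod>k<n. Q k)" for n
    by (induction n) (simp_all add: T_def Q_def mult_ac)
  have lim: "(\<lambda>n. T (2 * n)) \<longlonglongrightarrow> L"
    unfolding even L_def
    using convergent_prod_LIMSEQ[OF Q]
    by (intro tendsto_intros) (simp add: LIMSEQ_lessThan_iff_atMost)
  \<comment> \<open>The odd subsequence differs from the even one by a factor tending to 1, so it
    has the same limit.\<close>
  have "T (Suc (2 * n)) = T (2 * n) * tm_factor a b (2 * Suc n)" for n
    by (simp add: T_def)
  moreover have "(\<lambda>n. tm_factor a b (2 * Suc n)) \<longlonglongrightarrow> 1"
    using filterlim_compose[OF tm_factor_tendsto_1 filterlim_subseq[of "\<lambda>n. 2 * Suc n"]]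
    by (simp add: strict_mono_def)
  ultimately have "(\<lambda>n. T (Suc (2 * n))) \<longlonglongrightarrow> L"
    using tendsto_mult[OF lim] by fastforce
  with lim have "T \<longlonglongrightarrow> L"
    by (simp add: limseq_even_odd)
  moreover have "L \<noteq> 0"
    unfolding L_def using prodinf_nonzero[OF Q Q_nz] tm_factor_nonzero[OF a b, of 1] by simp
  ultimately show ?thesis
    using tm_factor_nonzero[OF a b]
    by (subst convergent_prod_iff_nz_lim) (auto simp: T_def)
qed

section \<open>Relations between values of \<open>tm_f\<close>\<close>

lemma tm_f_nonzero:
  assumes "a \<in> off_neg_ints" "b \<in> off_neg_ints"
  shows "tm_f a b \<noteq> 0"
  unfolding tm_f_def
  by (intro prodinf_nonzero convergent_prod_tm_factor tm_factor_nonzero assms) simp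

lemma tm_f_LIMSEQ:
  assumes "a \<in> off_neg_ints" "b \<in> off_neg_ints"
  shows "(\<lambda>n. \<Prod>k<n. tm_factor a b (Suc k)) \<longlonglongrightarrow> tm_f a b"
  using convergent_prod_LIMSEQ[OF convergent_prod_tm_factor[OF assms]]
  by (simp add: tm_f_def LIMSEQ_lessThan_iff_atMost)

lemma tm_f_exchange:
  assumes "a \<in> off_neg_ints" "b \<in> off_neg_ints" "c \<in> off_neg_ints" "d \<in> off_neg_ints"
  shows "tm_f a b * tm_f c d = tm_f a d * tm_f c b"
  unfolding tm_f_def
  by (simp only: prodinf_mult convergent_prod_tm_factor assms tm_factor_exchange[of a b _ c d])

lemma tm_f_refl:
  assumes "a \<in> off_neg_ints"
  shows "tm_f a a = 1"
proof -
  have "tm_factor a a (Suc n) = 1" for n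
    using of_nat_add_nonzero[OF assms, of "Suc n"] by (simp add: tm_factor_def del: of_nat_Suc)
  then show ?thesis by (simp add: tm_f_def)
qed

text \<open>The even indices give the product in the halves, the odd ones from 3 on an inverse
  product, and index 1 the prefactor, inverted because \<open>thue_morse 1 = 1\<close>. Regrouping
  happens in finite products and only then passes to the limit, so absolute convergence is not at
  issue.\<close>

lemma tm_f_split:
  assumes a: "a \<in> off_neg_ints" and b: "b \<in> off_neg_ints"
  shows "tm_f a b = (1 + b) / (1 + a) * (tm_f (a / 2) (b / 2) / tm_f ((a + 1) / 2) ((b + 1) / 2))"
proof -
  define T where "T = (\<lambda>a b n. \<Prod>k<n. tm_factor a b (Suc k))"
  have "thue_morse 1 = 1" by (simp add: thue_morse_def)
  then have first: "tm_factor a b 1 = (1 + b) / (1 + a)"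
    by (simp add: tm_factor_def power_int_minus)
  \<comment> \<open>An odd number of factors completes the last pair, so both products on the right
    have exactly \<open>n\<close> factors.\<close>
  have "T a b (Suc (2 * n)) =
      (1 + b) / (1 + a) * (T (a / 2) (b / 2) n / T ((a + 1) / 2) ((b + 1) / 2) n)" for n
  proof (induction n)
    case 0
    then show ?case using first by (simp add: T_def)
  next
    case (Suc n)
    have "T a b (Suc (2 * Suc n)) =
        T a b (Suc (2 * n)) * (tm_factor a b (2 * Suc n) * tm_factor a b (Suc (2 * Suc n)))"
      by (simp add: T_def mult_ac)
    then show ?case
      unfolding Suc tm_factor_double tm_factor_Suc_double by (simp add: T_def field_simps)
  qed
  moreover have "(\<lambda>n. T a b (Suc (2 * n))) \<longlonglongrightarrow> tm_f a b"
    unfolding T_def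
    by (rule filterlim_compose[OF tm_f_LIMSEQ[OF a b] filterlim_subseq]) (simp add: strict_mono_def)
  moreover have "(\<lambda>n. (1 + b) / (1 + a) * (T (a / 2) (b / 2) n / T ((a + 1) / 2) ((b + 1) / 2) n))
      \<longlonglongrightarrow> (1 + b) / (1 + a) * (tm_f (a / 2) (b / 2) / tm_f ((a + 1) / 2) ((b + 1) / 2))"
    unfolding T_def
    by (intro tendsto_mult tendsto_const tendsto_divide tm_f_LIMSEQ tm_f_nonzero
        half_in_off_neg_ints half_Suc_in_off_neg_ints a b)
  ultimately show ?thesis
    by (simp add: LIMSEQ_unique)
qed

section \<open>The function \<open>tm_g\<close>\<close>

lemma tm_g_nonzero:
  assumes "x \<in> off_neg_ints"
  shows "tm_g x \<noteq> 0"
  using tm_f_nonzero[OF half_in_off_neg_ints[OF assms] half_Suc_in_off_neg_ints[OF assms]]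
    of_nat_add_nonzero[OF assms, of 1]
  by (simp add: tm_g_def add.commute)

text \<open>Two exchanges, each with a trivial factor \<open>tm_f c c = 1\<close>, evaluate
  \<open>tm_f (a / 2) ((b + 1) / 2)\<close> once through \<open>b / 2\<close> and once through
  \<open>(a + 1) / 2\<close>; comparing them separates \<open>a\<close> from
  \<open>b\<close>.\<close>

lemma tm_f_eq_tm_g_divide:
  assumes a: "a \<in> off_neg_ints" and b: "b \<in> off_neg_ints"
  shows "tm_f a b = tm_g a / tm_g b"
proof -
  note in_dom = half_in_off_neg_ints half_Suc_in_off_neg_ints a b
  have "tm_f (a / 2) (b / 2) * tm_f (b / 2) ((b + 1) / 2)
      = tm_f (a / 2) ((b + 1) / 2) * tm_f (b / 2) (b / 2)"
    by (rule tm_f_exchange; intro in_dom)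
  moreover have "tm_f (a / 2) ((a + 1) / 2) * tm_f ((a + 1) / 2) ((b + 1) / 2)
      = tm_f (a / 2) ((b + 1) / 2) * tm_f ((a + 1) / 2) ((a + 1) / 2)"
    by (rule tm_f_exchange; intro in_dom)
  ultimately have "tm_f (a / 2) (b / 2) * tm_f (b / 2) ((b + 1) / 2)
      = tm_f (a / 2) ((a + 1) / 2) * tm_f ((a + 1) / 2) ((b + 1) / 2)"
    by (simp add: tm_f_refl in_dom)
  moreover have "tm_f (b / 2) ((b + 1) / 2) \<noteq> 0" "tm_f ((a + 1) / 2) ((b + 1) / 2) \<noteq> 0"
    by (intro tm_f_nonzero in_dom)+
  ultimately have "tm_f (a / 2) (b / 2) / tm_f ((a + 1) / 2) ((b + 1) / 2)
      = tm_f (a / 2) ((a + 1) / 2) / tm_f (b / 2) ((b + 1) / 2)"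
    by (simp add: frac_eq_eq)
  then show ?thesis
    by (simp add: tm_f_split[OF a b] tm_g_def add.commute mult.commute)
qed

lemma tm_g_functional_equation:
  assumes "x \<in> off_neg_ints"
  shows "(1 + x) * tm_g x = tm_g (x / 2) / tm_g ((x + 1) / 2)"
  using tm_f_eq_tm_g_divide[OF half_in_off_neg_ints[OF assms] half_Suc_in_off_neg_ints[OF assms]]
    of_nat_add_nonzero[OF assms, of 1]
  by (simp add: tm_g_def add.commute)

text \<open>Decides the sign of the square root in \<open>tm_g 1\<close>: the partial products stay
  in a closed set.\<close>

lemma tm_f_nonneg:
  assumes "a \<in> off_neg_ints" "b \<in> off_neg_ints" "a \<in> \<real>\<^sub>\<ge>\<^sub>0" "b \<in> \<real>\<^sub>\<ge>\<^sub>0"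
  shows "tm_f a b \<in> \<real>\<^sub>\<ge>\<^sub>0"
proof -
  have factor: "tm_factor a b n \<in> \<real>\<^sub>\<ge>\<^sub>0" for n
    using thue_morse_cases[of n] assms(3,4)
    by (auto simp: tm_factor_def power_int_minus simp del: inverse_divide
        intro!: nonneg_Reals_inverse_I nonneg_Reals_divide_I nonneg_Reals_add_I)
  have "(\<Prod>k<n. tm_factor a b (Suc k)) \<in> \<real>\<^sub>\<ge>\<^sub>0" for n
    by (induction n) (auto intro: factor nonneg_Reals_mult_I)
  then show ?thesis
    by (intro Lim_in_closed_set[OF closed_nonneg_Reals_complex _ _ tm_f_LIMSEQ[OF assms(1,2)]]) auto
qed

lemma nonneg_in_off_neg_ints:
  assumes "x \<in> \<real>\<^sub>\<ge>\<^sub>0"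
  shows "x \<in> off_neg_ints"
  using assms by (auto simp: off_neg_ints_def complex_nonneg_Reals_iff)

text \<open>Convergence is part of the claim, since \<open>prodinf\<close> has a meaningful value
  only for a convergent product.\<close>

theorem theorem2p2:
  shows "(\<forall>a\<in>off_neg_ints. \<forall>b\<in>off_neg_ints.
            convergent_prod (\<lambda>n. tm_factor a b (Suc n)) \<and> tm_f a b = tm_g a / tm_g b) \<and>
         (\<forall>x\<in>off_neg_ints. (1 + x) * tm_g x = tm_g (x / 2) / tm_g ((x + 1) / 2)) \<and>
         tm_g (1 / 2) = 1 \<and>
         tm_g 1 = complex_of_real (sqrt 2 / 2)"
proof (intro conjI ballI)
  have dom: "0 \<in> off_neg_ints" "1 \<in> off_neg_ints" "1 / 2 \<in> off_neg_ints"
    by (intro nonneg_in_off_neg_ints nonneg_Reals_divide_I; simp)+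
  \<comment> \<open>At \<open>x = 0\<close> the nonzero value \<open>tm_g 0\<close> cancels on both
    sides.\<close>
  show half: "tm_g (1 / 2) = 1"
    using tm_g_functional_equation[OF dom(1)] tm_g_nonzero[OF dom(1)] tm_g_nonzero[OF dom(3)]
    by (simp add: field_simps)
  have "tm_g 1 \<in> \<real>\<^sub>\<ge>\<^sub>0"
    using tm_f_nonneg[OF dom(3,2)] by (simp add: tm_g_def)
  then obtain r where r: "tm_g 1 = of_real r" "r \<ge> 0"
    by (auto elim: nonneg_Reals_cases)
  \<comment> \<open>At \<open>x = 1\<close> the point \<open>(x + 1) / 2\<close> is again 1, so
    \<open>2 * tm_g 1 = tm_g (1 / 2) / tm_g 1\<close>.\<close>
  have "2 * (tm_g 1 * tm_g 1) = 1"
    using tm_g_functional_equation[OF dom(2)] half tm_g_nonzero[OF dom(2)]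
    by (simp add: field_simps)
  then have "complex_of_real (2 * (r * r)) = of_real 1"
    unfolding r by simp
  then have "r ^ 2 = (sqrt 2 / 2) ^ 2"
    unfolding of_real_eq_iff by (simp add: power2_eq_square)
  then have "r = sqrt 2 / 2"
    using r(2) by (rule power2_eq_imp_eq) simp
  then show "tm_g 1 = complex_of_real (sqrt 2 / 2)"
    using r by (simp only:)
qed (simp_all only: convergent_prod_tm_factor tm_f_eq_tm_g_divide tm_g_functional_equation)

end
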